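(* Let $n\geq 1$. There is a constant $C$ depending only on $n$, and one may take $C=(2\pi e)^{\frac{n}{2}}$, such that the following holds. Let $f$ be a probability density function on $\mathbb{R}^n$ with finite covariance matrix $\Sigma_f$, let $\Omega\subseteq\mathbb{R}^n$ be measurable, and let $P(\Omega)=\int_\Omega f(x)\,d^nx$ be the probability of $\Omega$. Then for every $r>1$ (with $r=\infty$ allowed), $$P(\Omega)^{1+\frac{n}{2}-\frac{n}{2r}}\leq \left(C(\det\Sigma_f)^{\frac{1}{2}}\right)^{1-\frac{1}{r}}\|fI_\Omega\|_r.$$
   Context: All integrals are with respect to Lebesgue measure. For $0<p<\infty$, $\|g\|_p=\left(\int_{\mathbb{R}^n}|g(x)|^p\,d^nx\right)^{1/p}$, and $\|g\|_\infty=\operatorname{ess\,sup}_{x\in\mathbb{R}^n}|g(x)|$ (norms may equal $+\infty$); when $r=\infty$, $\frac1r$ is read as $0$. $I_\Omega$ is the indicator function of $\Omega$. The covariance matrix of $f$ is $\Sigma_f=\int_{\mathbb{R}^n}(x-m)(x-m)^Tf(x)\,d^nx$ with $m=\int_{\mathbb{R}^n}xf(x)\,d^nx$; it is finite when $\int_{\mathbb{R}^n}|x|^2f(x)\,d^nx<\infty$. *)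

theory Defs
  imports "HOL-Probability.Probability"
begin

definition prob_density :: "(real ^ 'n \<Rightarrow> real) \<Rightarrow> bool" where
  "prob_density f \<longleftrightarrow> (\<forall>x. 0 \<le> f x) \<and> has_bochner_integral lebesgue f 1"

definition mean_vec :: "(real ^ 'n \<Rightarrow> real) \<Rightarrow> real ^ 'n" where
  "mean_vec f = (LINT x|lebesgue. f x *\<^sub>R x)"

text \<open>The matrix-valued integral is taken entrywise. The Bochner integral of a non-integrable
  function is 0, so the entries are meaningful only under \<open>finite_second_moment\<close>.\<close>

definition cov_matrix :: "(real ^ 'n \<Rightarrow> real) \<Rightarrow> real ^ 'n ^ 'n" where
  "cov_matrix f =
    (\<chi> i j. LINT x|lebesgue. (x $ i - mean_vec f $ i) * (x $ j - mean_vec f $ j) * f x)"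

definition finite_second_moment :: "(real ^ 'n \<Rightarrow> real) \<Rightarrow> bool" where
  "finite_second_moment f \<longleftrightarrow> integrable lebesgue (\<lambda>x. (norm x)\<^sup>2 * f x)"

text \<open>Only for \<open>0 < p\<close>. The value is extended so that a norm may be infinite; as powers are
  only available on \<^typ>\<open>real\<close>, the outer power of an infinite integral is set to \<open>\<infinity>\<close>.\<close>

definition Lp_norm :: "ennreal \<Rightarrow> (real ^ 'n \<Rightarrow> real) \<Rightarrow> ennreal" where
  "Lp_norm p g =
    (if p = \<infinity> then esssup lebesgue (\<lambda>x. ennreal \<bar>g x\<bar>)
     else let I = (\<integral>\<^sup>+ x. ennreal (\<bar>g x\<bar> powr enn2real p) \<partial>lebesgue)
          in if I = \<infinity> then \<infinity> else ennreal (enn2real I powr (1 / enn2real p)))"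

end

theory Submission
  imports Defs
begin

text \<open>Let \<open>h = f I\<^sub>\<Omega>\<close>, \<open>P = P(\<Omega>)\<close>, \<open>\<alpha> = 1 - 1/r\<close>, and let \<open>\<psi>\<close> be the Gaussian density with the mean
  of \<open>f\<close> and covariance \<open>\<Sigma>\<^sub>f / P\<close>. Hoelder's inequality with exponents \<open>r\<close> and \<open>1/\<alpha>\<close> gives
  \<open>\<integral>h \<psi>\<^sup>\<alpha> \<le> \<parallel>h\<parallel>\<^sub>r\<close> because \<open>\<psi>\<close> has mass 1. In the other direction, Jensen's inequality for
  the probability density \<open>h / P\<close> bounds \<open>\<integral>h \<psi>\<^sup>\<alpha>\<close> from below by an exponential of \<open>\<integral>h log \<psi>\<close>,
  and since \<open>h \<le> f\<close>, the quadratic part of that integral is at most the one of \<open>f\<close>, which is \<open>n P\<close>.\<close>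

section \<open>Linear change of variables for Lebesgue measure\<close>

text \<open>Fubini with the coordinate along \<open>e\<close> innermost: \<open>c\<close> is
  constant on each line parallel to \<open>e\<close>, so on such a line the shear is a translation,
  which leaves the inner integral unchanged.\<close>

lemma nn_integral_lborel_shear:
  fixes e :: "'a::euclidean_space" and g :: "'a \<Rightarrow> ennreal"
  assumes [measurable]: "g \<in> borel_measurable borel" "c \<in> borel_measurable borel"
    and e: "e \<in> Basis" and c: "\<And>x t. c (x + t *\<^sub>R e) = c x"
  shows "(\<integral>\<^sup>+x. g (x + c x *\<^sub>R e) \<partial>lborel) = (\<integral>\<^sup>+x. g x \<partial>lborel)"
proof -
  interpret product_sigma_finite "\<lambda>_::'a. lborel :: real measure" ..
  let ?v = "\<lambda>x::'a \<Rightarrow> real. \<Sum>b\<in>Basis. x b *\<^sub>R b"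
  have *: "(\<integral>\<^sup>+x. G x \<partial>lborel) =
      (\<integral>\<^sup>+x. (\<integral>\<^sup>+y. G (?v (x(e := y))) \<partial>lborel) \<partial>Pi\<^sub>M (Basis - {e}) (\<lambda>_. lborel))"
    if [measurable]: "G \<in> borel_measurable borel" for G :: "'a \<Rightarrow> ennreal"
  proof -
    have B: "insert e (Basis - {e}) = (Basis :: 'a set)" using e by auto
    have "(\<integral>\<^sup>+x. G x \<partial>lborel) = (\<integral>\<^sup>+x. G (?v x) \<partial>Pi\<^sub>M Basis (\<lambda>_. lborel))"
      unfolding lborel_def[where 'a='a] lborel_eq_real[symmetric]
      by (subst nn_integral_distr) (auto simp: lborel_eq_real[symmetric] cong: measurable_cong_sets)
    also have "\<dots> = (\<integral>\<^sup>+x. G (?v x) \<partial>Pi\<^sub>M (insert e (Basis - {e})) (\<lambda>_. lborel))"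
      by (simp only: B)
    also have "\<dots> = (\<integral>\<^sup>+x. (\<integral>\<^sup>+y. G (?v (x(e := y))) \<partial>lborel) \<partial>Pi\<^sub>M (Basis - {e}) (\<lambda>_. lborel))"
      by (rule product_nn_integral_insert) (auto simp: B)
    finally show ?thesis .
  qed
  have v: "?v (x(e := y)) = ?v (x(e := 0)) + y *\<^sub>R e" for x y
  proof -
    have "?v (x(e := y)) = y *\<^sub>R e + (\<Sum>b\<in>Basis - {e}. (x(e := y)) b *\<^sub>R b)" for y
      using e by (subst sum.remove[of _ e]) auto
    moreover have "(\<Sum>b\<in>Basis - {e}. (x(e := y)) b *\<^sub>R b) = (\<Sum>b\<in>Basis - {e}. (x(e := 0)) b *\<^sub>R b)"
      by (intro sum.cong) auto
    ultimately show ?thesis by simp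
  qed
  have "(\<integral>\<^sup>+y. g (?v (x(e := y)) + c (?v (x(e := y))) *\<^sub>R e) \<partial>lborel)
      = (\<integral>\<^sup>+y. g (?v (x(e := y))) \<partial>lborel)" (is "?L x = ?R x") for x
  proof -
    let ?w = "?v (x(e := 0))"
    \<comment> \<open>The shift is frozen at its value at the base point \<open>?w\<close> of the
      line. Writing \<open>1 * y\<close> matches the affine substitution with slope 1 and offset
      \<open>c ?w\<close>.\<close>
    have "(\<integral>\<^sup>+y. g (?v (x(e := y)) + c (?v (x(e := y))) *\<^sub>R e) \<partial>lborel)
        = (\<integral>\<^sup>+y. g (?w + (c ?w + 1 * y) *\<^sub>R e) \<partial>lborel)"
      by (subst (1 2) v) (simp only: c, simp add: algebra_simps)
    also have "\<dots> = (\<integral>\<^sup>+y. g (?w + y *\<^sub>R e) \<partial>lborel)"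
      by (subst (2) nn_integral_real_affine[of _ 1 "c ?w"]) auto
    also have "\<dots> = (\<integral>\<^sup>+y. g (?v (x(e := y))) \<partial>lborel)"
      by (intro nn_integral_cong arg_cong[where f=g] v[symmetric])
    finally show ?thesis .
  qed
  note eq = this
  have "(\<integral>\<^sup>+x. g (x + c x *\<^sub>R e) \<partial>lborel)
      = (\<integral>\<^sup>+x. ?L x \<partial>Pi\<^sub>M (Basis - {e}) (\<lambda>_. lborel))"
    by (rule *) simp
  also have "\<dots> = (\<integral>\<^sup>+x. ?R x \<partial>Pi\<^sub>M (Basis - {e}) (\<lambda>_. lborel))"
    by (rule nn_integral_cong) (rule eq)
  also have "\<dots> = (\<integral>\<^sup>+x. g x \<partial>lborel)"
    by (rule *[symmetric]) simp
  finally show ?thesis .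
qed

lemma det_matrix_shear:
  fixes m n :: "'n::finite"
  assumes "m \<noteq> n"
  shows "det (matrix (\<lambda>x::real^'n. \<chi> i. if i = m then x$m + x$n else x$i)) = 1"
proof -
  have "matrix (\<lambda>x::real^'n. \<chi> i. if i = m then x$m + x$n else x$i)
      = (\<chi> k. if k = m then row m (mat 1) + 1 *s row n (mat 1) else row k (mat 1))"
    by (auto simp: matrix_def vec_eq_iff row_def mat_def axis_def)
  then show ?thesis
    using det_row_operation[OF assms, of "mat 1 :: real^'n^'n" 1] by simp
qed

lemma abs_det_matrix_swap:
  fixes m n :: "'n::finite"
  shows "\<bar>det (matrix (\<lambda>x::real^'n. \<chi> i. x $ Transposition.transpose m n i))\<bar> = 1"
proof -
  have "matrix (\<lambda>x::real^'n. \<chi> i. x $ Transposition.transpose m n i)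
      = (\<chi> i. (mat 1 :: real^'n^'n) $ Transposition.transpose m n i)"
    by (auto simp: matrix_def vec_eq_iff mat_def axis_def)
  then show ?thesis
    by (simp add: det_permute_rows permutes_swap_id sign_swap_id abs_mult)
qed

text \<open>A measure that gives every open box its volume is Lebesgue measure. Swapping coordinates
  sends boxes to boxes and only reorders the side lengths.\<close>

lemma lborel_distr_swap:
  fixes m n :: "'n::finite"
  shows "distr lborel borel (\<lambda>x::real^'n. \<chi> i. x $ Transposition.transpose m n i) = lborel"
    (is "distr _ _ ?s = _")
proof (rule lborel_eqI[symmetric])
  fix l u :: "real^'n"
  assume le: "\<And>b. b \<in> Basis \<Longrightarrow> l \<bullet> b \<le> u \<bullet> b"
  have le': "l $ i \<le> u $ i" for i
    using le[of "axis i 1"] by (auto simp: inner_axis axis_in_Basis_iff)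
  have [measurable]: "?s \<in> borel_measurable borel"
    by (intro borel_measurable_continuous_onI continuous_intros)
  have P: "(\<Prod>b\<in>Basis. (u - l) \<bullet> b) = (\<Prod>i\<in>UNIV. u $ i - l $ i)" for u l :: "real^'n"
  proof -
    have B: "(Basis :: (real^'n) set) = (\<lambda>i. axis i 1) ` UNIV"
      by (auto simp: Basis_vec_def)
    have inj: "inj (\<lambda>i::'n. axis i (1::real))"
      by (auto simp: inj_on_def axis_eq_axis)
    show ?thesis
      unfolding B prod.reindex[OF inj] by (simp add: inner_axis o_def)
  qed
  \<comment> \<open>A transposition is its own inverse, so taking the preimage swaps the corners in
    the same way.\<close>
  have "?s -` box l u = box (?s l) (?s u)"
    by (auto simp: mem_box_cart) (metis transpose_involutory)+
  then have "emeasure (distr lborel borel ?s) (box l u) = emeasure lborel (box (?s l) (?s u))"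
    by (simp add: emeasure_distr)
  also have "\<dots> = (\<Prod>b\<in>Basis. (?s u - ?s l) \<bullet> b)"
    using le' by (intro emeasure_lborel_box) (auto simp: Basis_vec_def inner_axis)
  also have "(\<Prod>b\<in>Basis. (?s u - ?s l) \<bullet> b) = (\<Prod>i\<in>UNIV. u $ Transposition.transpose m n i - l $ Transposition.transpose m n i)"
    by (simp add: P)
  also have "\<dots> = (\<Prod>i\<in>UNIV. u $ i - l $ i)"
    by (rule prod.permute[symmetric, where g="\<lambda>i. u $ i - l $ i", unfolded o_def]) (simp add: permutes_swap_id)
  finally show "emeasure (distr lborel borel ?s) (box l u) = (\<Prod>b\<in>Basis. (u - l) \<bullet> b)"
    by (simp add: P)
qed simp

text \<open>The change of variables theorems of the library require an index type of class
  \<^class>\<open>wellorder\<close>.\<close>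

lemma nn_integral_lborel_linear:
  fixes f :: "real^'n \<Rightarrow> real^'n" and g :: "real^'n \<Rightarrow> ennreal"
  assumes "linear f" "det (matrix f) \<noteq> 0" "g \<in> borel_measurable borel"
  shows "(\<integral>\<^sup>+x. g x \<partial>lborel) = ennreal \<bar>det (matrix f)\<bar> * (\<integral>\<^sup>+x. g (f x) \<partial>lborel)"
proof -
  \<comment> \<open>Induction over elementary linear maps. Quantifying over \<open>g\<close> lets
    the composition case use the hypothesis for \<open>h\<close> at
    \<open>\<lambda>x. g (f x)\<close>; the premise on the determinant passes to both factors and
    makes the case of a vanishing coordinate vacuous.\<close>
  have "det (matrix f) \<noteq> 0 \<longrightarrow> (\<forall>g \<in> borel_measurable borel.
      (\<integral>\<^sup>+x. g x \<partial>lborel) = ennreal \<bar>det (matrix f)\<bar> * (\<integral>\<^sup>+x. g (f x) \<partial>lborel))"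
    (is "?P f")
  proof (rule induct_linear_elementary[OF \<open>linear f\<close>])
    fix f h :: "real^'n \<Rightarrow> real^'n"
    assume lin: "linear f" "linear h" and f: "?P f" and h: "?P h"
    have d: "det (matrix (f \<circ> h)) = det (matrix f) * det (matrix h)"
      using matrix_compose[OF lin(2,1)] by (simp add: det_mul)
    have [measurable]: "f \<in> borel_measurable borel"
      using lin(1) by (intro borel_measurable_continuous_onI linear_continuous_on) (simp add: linear_linear)
    show "?P (f \<circ> h)"
    proof (intro impI ballI)
      fix g :: "real^'n \<Rightarrow> ennreal"
      assume nz: "det (matrix (f \<circ> h)) \<noteq> 0" and [measurable]: "g \<in> borel_measurable borel"
      have "(\<integral>\<^sup>+x. g x \<partial>lborel) = ennreal \<bar>det (matrix f)\<bar> * (\<integral>\<^sup>+x. g (f x) \<partial>lborel)"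
        by (rule f[rule_format]) (use nz d in auto)
      also have "(\<integral>\<^sup>+x. g (f x) \<partial>lborel) = ennreal \<bar>det (matrix h)\<bar> * (\<integral>\<^sup>+x. g (f (h x)) \<partial>lborel)"
        by (rule h[rule_format, of "\<lambda>x. g (f x)"]) (use nz d in auto)
      finally show "(\<integral>\<^sup>+x. g x \<partial>lborel) = ennreal \<bar>det (matrix (f \<circ> h))\<bar> * (\<integral>\<^sup>+x. g ((f \<circ> h) x) \<partial>lborel)"
        by (simp add: d abs_mult ennreal_mult mult.assoc)
    qed
  next
    fix f :: "real^'n \<Rightarrow> real^'n" and i
    assume "linear f" "\<And>x. f x $ i = 0"
    then have "det (matrix f) = 0"
      by (intro det_zero_row(1)[of i]) (simp add: row_def matrix_def vec_eq_iff)
    then show "?P f" by simp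
  next
    fix c :: "'n \<Rightarrow> real"
    let ?T = "\<lambda>x::real^'n. \<chi> i. c i * x $ i"
    have det: "det (matrix ?T) = prod c UNIV"
      by (simp add: axis_def matrix_def det_diagonal)
    have ran: "(Basis :: (real^'n) set) = (\<lambda>i. axis i 1) ` UNIV"
      by (auto simp: Basis_vec_def)
    have inj: "inj (\<lambda>i::'n. axis i (1::real))"
      by (auto simp: inj_on_def axis_eq_axis)
    \<comment> \<open>The scaling factors, reindexed by basis vectors instead of indices to fit
      \<open>lborel_affine_euclidean\<close>.\<close>
    define d where "d = (\<lambda>b. c (SOME i. b = axis i (1::real)))"
    have d: "d (axis i 1) = c i" for i
      unfolding d_def by (rule someI2[of _ i]) (auto simp: axis_eq_axis)
    show "?P ?T"
    proof (intro impI ballI)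
      fix g :: "real^'n \<Rightarrow> ennreal"
      assume nz: "det (matrix ?T) \<noteq> 0" and [measurable]: "g \<in> borel_measurable borel"
      have [measurable]: "?T \<in> borel_measurable borel"
        by (intro borel_measurable_continuous_onI continuous_intros)
      have T: "(\<lambda>x. 0 + (\<Sum>j\<in>Basis. (d j * (x \<bullet> j)) *\<^sub>R j)) = ?T"
        unfolding ran sum.reindex[OF inj] o_def d
        by (simp add: fun_eq_iff inner_axis vec_eq_iff) (simp add: axis_def if_distrib cong: if_cong)
      have "d j \<noteq> 0" if "j \<in> Basis" for j
        using that nz by (auto simp: ran d det)
      from lborel_affine_euclidean[of d 0, OF this]
      have "lborel = density (distr lborel borel ?T) (\<lambda>_. (\<Prod>j\<in>Basis. \<bar>d j\<bar>))"
        unfolding T .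
      also have "(\<Prod>j\<in>Basis. \<bar>d j\<bar>) = \<bar>prod c UNIV\<bar>"
        by (simp add: ran prod.reindex inj d abs_prod)
      finally have "(\<integral>\<^sup>+x. g x \<partial>lborel)
          = (\<integral>\<^sup>+x. g x \<partial>density (distr lborel borel ?T) (\<lambda>_. ennreal \<bar>prod c UNIV\<bar>))"
        by simp
      also have "\<dots> = ennreal \<bar>prod c UNIV\<bar> * (\<integral>\<^sup>+x. g (?T x) \<partial>lborel)"
        by (simp add: nn_integral_density nn_integral_distr nn_integral_cmult)
      finally show "(\<integral>\<^sup>+x. g x \<partial>lborel) = ennreal \<bar>det (matrix ?T)\<bar> * (\<integral>\<^sup>+x. g (?T x) \<partial>lborel)"
        unfolding det .
    qed
  next
    fix m n :: 'n
    let ?s = "\<lambda>x::real^'n. \<chi> i. x $ Transposition.transpose m n i"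
    have [measurable]: "?s \<in> borel_measurable borel"
      by (intro borel_measurable_continuous_onI continuous_intros)
    have "(\<integral>\<^sup>+x. g x \<partial>lborel) = (\<integral>\<^sup>+x. g (?s x) \<partial>lborel)"
      if [measurable]: "g \<in> borel_measurable borel" for g :: "real^'n \<Rightarrow> ennreal"
      by (subst lborel_distr_swap[of m n, symmetric]) (simp add: nn_integral_distr)
    then show "?P ?s"
      unfolding abs_det_matrix_swap ennreal_1 mult_1 by blast
  next
    fix m n :: 'n
    assume "m \<noteq> n"
    let ?h = "\<lambda>x::real^'n. \<chi> i. if i = m then x$m + x$n else x$i"
    have h: "?h x = x + (x $ n) *\<^sub>R axis m 1" for x
      by (auto simp: vec_eq_iff axis_def)
    have "(\<integral>\<^sup>+x. g x \<partial>lborel) = (\<integral>\<^sup>+x. g (?h x) \<partial>lborel)"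
      if [measurable]: "g \<in> borel_measurable borel" for g :: "real^'n \<Rightarrow> ennreal"
      unfolding h using \<open>m \<noteq> n\<close>
      by (intro nn_integral_lborel_shear[symmetric]) (auto simp: axis_def Basis_vec_def intro!: borel_measurable_continuous_onI continuous_intros)
    then show "?P ?h"
      unfolding det_matrix_shear[OF \<open>m \<noteq> n\<close>] abs_one ennreal_1 mult_1 by blast
  qed
  with assms show ?thesis by blast
qed

section \<open>The standard Gaussian integral\<close>

text \<open>The integrand is a product over coordinates, so the integral is a power of the
  one-dimensional one, which is read off from the normalisation of
  \<open>std_normal_density\<close>.\<close>

lemma nn_integral_gaussian:
  "(\<integral>\<^sup>+x. ennreal (exp (- (norm (x::'a::euclidean_space))\<^sup>2 / 2)) \<partial>lborel)
    = ennreal ((2 * pi) powr (real DIM('a) / 2))"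
proof -
  have 1: "(\<integral>\<^sup>+t. ennreal (exp (- t\<^sup>2 / 2)) \<partial>lborel) = ennreal (sqrt (2 * pi))"
  proof -
    have "(\<integral>\<^sup>+t. ennreal (exp (- t\<^sup>2 / 2)) \<partial>lborel)
        = (\<integral>\<^sup>+t. ennreal (sqrt (2 * pi)) * ennreal (std_normal_density t) \<partial>lborel)"
      by (intro nn_integral_cong) (simp add: std_normal_density_def ennreal_mult[symmetric])
    also have "\<dots> = ennreal (sqrt (2 * pi)) * (\<integral>\<^sup>+t. ennreal (std_normal_density t) \<partial>lborel)"
      by (rule nn_integral_cmult) simp
    also have "(\<integral>\<^sup>+t. ennreal (std_normal_density t) \<partial>lborel) = 1"
      by (subst nn_integral_eq_integral) auto
    finally show ?thesis by simp
  qed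
  have "exp (- (norm x)\<^sup>2 / 2) = (\<Prod>b\<in>Basis. exp (- (x \<bullet> b)\<^sup>2 / 2))" for x :: 'a
    unfolding power2_norm_eq_inner euclidean_inner[of x x]
    by (simp add: exp_sum[symmetric] sum_negf sum_divide_distrib[symmetric] power2_eq_square)
  then have "(\<integral>\<^sup>+x. ennreal (exp (- (norm (x::'a))\<^sup>2 / 2)) \<partial>lborel)
      = (\<integral>\<^sup>+x. (\<Prod>b\<in>Basis. ennreal (exp (- ((x::'a) \<bullet> b)\<^sup>2 / 2))) \<partial>lborel)"
    by (simp add: prod_ennreal)
  also have "\<dots> = (\<Prod>b\<in>(Basis::'a set). (\<integral>\<^sup>+t. ennreal (exp (- t\<^sup>2 / 2)) \<partial>lborel))"
    by (rule nn_integral_lborel_prod) auto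
  also have "\<dots> = ennreal (sqrt (2 * pi) ^ DIM('a))"
    unfolding 1 by (simp add: ennreal_power)
  also have "sqrt (2 * pi) ^ DIM('a) = (2 * pi) powr (real DIM('a) / 2)"
    by (simp add: powr_half_sqrt[symmetric] powr_power)
  finally show ?thesis .
qed

section \<open>Hoelder and Jensen bounds\<close>

text \<open>This is the upper bound for the integral of \<open>h\<close> against a power of the
  Gaussian. For finite \<open>r\<close> it comes from integrating Young's inequality for the
  normalised functions; for \<open>r = \<infinity>\<close> the exponent is 1 and \<open>h\<close> is
  bounded by its essential supremum.\<close>

lemma Holder_Lp_norm:
  fixes h \<psi> :: "real^'n \<Rightarrow> real"
  assumes [measurable]: "h \<in> borel_measurable lebesgue" "\<psi> \<in> borel_measurable lebesgue"
    and h: "\<And>x. 0 \<le> h x" and \<psi>: "\<And>x. 0 \<le> \<psi> x"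
    and le1: "(\<integral>\<^sup>+x. ennreal (\<psi> x) \<partial>lebesgue) \<le> 1" and r: "1 < r"
  shows "(\<integral>\<^sup>+x. ennreal (h x * \<psi> x powr (1 - enn2real (1 / r))) \<partial>lebesgue) \<le> Lp_norm r h"
proof (cases "r = \<infinity>")
  case True
  let ?E = "esssup lebesgue (\<lambda>x. ennreal \<bar>h x\<bar>)"
  have "(\<integral>\<^sup>+x. ennreal (h x * \<psi> x powr (1 - enn2real (1 / r))) \<partial>lebesgue)
      = (\<integral>\<^sup>+x. ennreal \<bar>h x\<bar> * ennreal (\<psi> x) \<partial>lebesgue)"
    using h \<psi> by (simp add: True ennreal_mult)
  also have "\<dots> \<le> (\<integral>\<^sup>+x. ?E * ennreal (\<psi> x) \<partial>lebesgue)"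
  proof (rule nn_integral_mono_AE)
    show "AE x in lebesgue. ennreal \<bar>h x\<bar> * ennreal (\<psi> x) \<le> ?E * ennreal (\<psi> x)"
      using esssup_AE[where M = lebesgue and f = "\<lambda>x. ennreal \<bar>h x\<bar>"]
      by eventually_elim (rule mult_right_mono, auto)
  qed
  also have "\<dots> = ?E * (\<integral>\<^sup>+x. ennreal (\<psi> x) \<partial>lebesgue)"
    by (rule nn_integral_cmult) simp
  also have "\<dots> \<le> ?E"
    using mult_left_mono[OF le1, of ?E] by simp
  finally show ?thesis
    by (simp add: Lp_norm_def True)
next
  case False
  define p where "p = enn2real r"
  have rp: "r = ennreal p"
    using False by (simp add: p_def less_top)
  have p: "1 < p"
    using r unfolding rp by simp
  have inv: "enn2real (1 / r) = 1 / p"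
    using p unfolding rp by (simp add: divide_ennreal flip: ennreal_1)
  define \<alpha> where "\<alpha> = 1 - 1 / p"
  have \<alpha>: "0 < \<alpha>" "1 / p + \<alpha> = 1"
    using p by (auto simp: \<alpha>_def)
  define I where "I = (\<integral>\<^sup>+x. ennreal (\<bar>h x\<bar> powr p) \<partial>lebesgue)"
  show ?thesis
  proof (cases "I = \<infinity>")
    case True
    then have "Lp_norm r h = \<infinity>"
      using False by (simp add: Lp_norm_def I_def p_def)
    then show ?thesis by simp
  next
    case fin: False
    define i where "i = enn2real I"
    have i: "I = ennreal i" "0 \<le> i"
      using fin by (auto simp: i_def less_top)
    have Lp: "Lp_norm r h = ennreal (i powr (1 / p))"
      using False fin by (simp add: Lp_norm_def I_def[symmetric] p_def[symmetric] i_def)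
    show ?thesis
    \<comment> \<open>The normalisation below divides by \<open>i\<close>. If \<open>i = 0\<close>,
      then \<open>h\<close> vanishes almost everywhere and so does the left-hand integrand.\<close>
    proof (cases "i = 0")
      case True
      then have "(\<integral>\<^sup>+x. ennreal (\<bar>h x\<bar> powr p) \<partial>lebesgue) = 0"
        using i(1) by (simp add: I_def)
      then have "AE x in lebesgue. ennreal (\<bar>h x\<bar> powr p) = 0"
        by (subst (asm) nn_integral_0_iff_AE) auto
      then have "AE x in lebesgue. h x = 0"
        by eventually_elim auto
      then have "(\<integral>\<^sup>+x. ennreal (h x * \<psi> x powr (1 - enn2real (1 / r))) \<partial>lebesgue) = 0"
        by (subst nn_integral_0_iff_AE) auto
      then show ?thesis by simp
    next
      case False
      with i(2) have i0: "0 < i" by simp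
      define N where "N = i powr (1 / p)"
      have N: "0 < N" using i0 by (simp add: N_def)
      \<comment> \<open>Young's inequality with weights \<open>1 / p\<close> and \<alpha> for
        \<open>h x powr p / i\<close> and \<open>\<psi> x\<close>, multiplied by the norm
        \<open>N\<close> of \<open>h\<close>. After integration the two terms contribute at most
        \<open>N / p\<close> and \<open>N * \<alpha>\<close>, which add up to
        \<open>N\<close>.\<close>
      have pt: "h x * \<psi> x powr \<alpha> \<le> N / (p * i) * \<bar>h x\<bar> powr p + N * \<alpha> * \<psi> x" for x
      proof (cases "h x = 0 \<or> \<psi> x = 0")
        case True
        then show ?thesis
          using N \<alpha> i0 p \<psi>[of x] by auto
      next
        case False
        then have pos: "0 < h x" "0 < \<psi> x"
          using h[of x] \<psi>[of x] by auto
        have "(h x powr p / i) powr (1 / p) * \<psi> x powr \<alpha> \<le> 1 / p * (h x powr p / i) + \<alpha> * \<psi> x"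
          using pos p \<alpha> i0 by (intro Youngs_inequality_0) auto
        also have "(h x powr p / i) powr (1 / p) = h x / N"
          using pos i0 p by (simp add: powr_divide powr_powr N_def)
        finally have "N * (h x / N * \<psi> x powr \<alpha>) \<le> N * (1 / p * (h x powr p / i) + \<alpha> * \<psi> x)"
          using N by (intro mult_left_mono) auto
        then show ?thesis
          using N pos by (simp add: field_simps)
      qed
      have "(\<integral>\<^sup>+x. ennreal (h x * \<psi> x powr \<alpha>) \<partial>lebesgue)
          \<le> (\<integral>\<^sup>+x. ennreal (N / (p * i)) * ennreal (\<bar>h x\<bar> powr p) + ennreal (N * \<alpha>) * ennreal (\<psi> x) \<partial>lebesgue)"
        using pt N p i0 \<alpha> \<psi>
        by (intro nn_integral_mono) (simp flip: ennreal_mult ennreal_plus)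
      also have "\<dots> = ennreal (N / (p * i)) * I + ennreal (N * \<alpha>) * (\<integral>\<^sup>+x. ennreal (\<psi> x) \<partial>lebesgue)"
        unfolding I_def by (simp add: nn_integral_add nn_integral_cmult)
      also have "\<dots> \<le> ennreal (N / (p * i)) * I + ennreal (N * \<alpha>) * 1"
        by (intro add_left_mono mult_left_mono le1) simp
      also have "\<dots> = ennreal (N / (p * i) * i + N * \<alpha>)"
        using N p i0 \<alpha> by (simp add: i flip: ennreal_mult)
      also have "N / (p * i) * i + N * \<alpha> = N * (1 / p + \<alpha>)"
        using i0 p by (simp add: field_simps)
      finally show ?thesis
        unfolding Lp inv \<alpha>(2) by (simp add: \<alpha>_def N_def)
    qed
  qed
qed

text \<open>Jensen's inequality for the exponential, from the tangent line at the bound \<open>d\<close> of the mean.\<close>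

lemma Jensen_exp_powr:
  fixes h q :: "'a \<Rightarrow> real"
  assumes h: "integrable M h" "\<And>x. 0 \<le> h x"
    and hq: "integrable M (\<lambda>x. h x * q x)" "(\<integral>x. h x * q x \<partial>M) \<le> d * (\<integral>x. h x \<partial>M)"
    and q [measurable]: "q \<in> borel_measurable M"
    and "0 < \<kappa>" "0 \<le> \<alpha>"
  shows "ennreal ((\<integral>x. h x \<partial>M) * (\<kappa> * exp (- d / 2)) powr \<alpha>)
    \<le> (\<integral>\<^sup>+x. ennreal (h x * (\<kappa> * exp (- q x / 2)) powr \<alpha>) \<partial>M)" (is "_ \<le> ?R")
proof (cases "?R = \<infinity>")
  case False
  define c where "c = (\<kappa> * exp (- d / 2)) powr \<alpha>"
  have [measurable]: "h \<in> borel_measurable M" using h(1) by auto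
  \<comment> \<open>Finiteness of \<open>?R\<close> makes this integrand integrable, so the rest can
    be done with real-valued integrals.\<close>
  have int: "integrable M (\<lambda>x. h x * (\<kappa> * exp (- q x / 2)) powr \<alpha>)"
    using False h(2) by (intro integrableI_nonneg) (auto simp: less_top)
  \<comment> \<open>The constant \<open>c\<close> is the value at \<open>q x = d\<close>; the
    remaining factor \<open>exp (\<alpha> * (d - q x) / 2)\<close> is bounded below by 1 plus its
    exponent.\<close>
  have pt: "c * (1 + \<alpha> * d / 2) * h x - c * (\<alpha> / 2) * (h x * q x) \<le> h x * (\<kappa> * exp (- q x / 2)) powr \<alpha>" for x
  proof -
    have "(\<kappa> * exp (- q x / 2)) powr \<alpha> = c * exp (\<alpha> * d / 2 - \<alpha> * q x / 2)"
      using \<open>0 < \<kappa>\<close> unfolding c_def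
      by (simp add: powr_def ln_mult mult_exp_exp algebra_simps)
    moreover have "c * (1 + (\<alpha> * d / 2 - \<alpha> * q x / 2)) \<le> c * exp (\<alpha> * d / 2 - \<alpha> * q x / 2)"
      by (intro mult_left_mono exp_ge_add_one_self) (simp add: c_def)
    ultimately have "h x * (c * (1 + (\<alpha> * d / 2 - \<alpha> * q x / 2))) \<le> h x * (\<kappa> * exp (- q x / 2)) powr \<alpha>"
      using h(2) by (metis mult_left_mono)
    then show ?thesis by (simp add: algebra_simps)
  qed
  have "(\<integral>x. h x \<partial>M) * c \<le> c * (1 + \<alpha> * d / 2) * (\<integral>x. h x \<partial>M) - c * (\<alpha> / 2) * (\<integral>x. h x * q x \<partial>M)"
    using mult_left_mono[OF hq(2), of "c * (\<alpha> / 2)"] \<open>0 \<le> \<alpha>\<close> by (simp add: c_def algebra_simps)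
  also have "\<dots> = (\<integral>x. c * (1 + \<alpha> * d / 2) * h x - c * (\<alpha> / 2) * (h x * q x) \<partial>M)"
    using h(1) hq(1) by simp
  also have "\<dots> \<le> (\<integral>x. h x * (\<kappa> * exp (- q x / 2)) powr \<alpha> \<partial>M)"
    using h(1) hq(1) int pt by (intro integral_mono) auto
  finally have "ennreal ((\<integral>x. h x \<partial>M) * c) \<le> ennreal (\<integral>x. h x * (\<kappa> * exp (- q x / 2)) powr \<alpha> \<partial>M)"
    by (rule ennreal_leI)
  also have "\<dots> = ?R"
    using int h(2) by (subst nn_integral_eq_integral) auto
  finally show ?thesis by (simp add: c_def)
qed simp

section \<open>Whitening a positive definite form, and the matching Gaussian\<close>

text \<open>Gram-Schmidt for the inner product defined by \<open>S\<close>, adding one vector at a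
  time.\<close>

lemma exists_orthonormal_for_form:
  fixes S :: "real^'n^'n"
  assumes sym: "transpose S = S" and pos: "\<And>v. v \<noteq> 0 \<Longrightarrow> 0 < v \<bullet> (S *v v)"
    and "k \<le> CARD('n)"
  shows "\<exists>T. finite T \<and> card T = k \<and> (\<forall>u\<in>T. \<forall>v\<in>T. u \<bullet> (S *v v) = (if u = v then 1 else 0))"
  using \<open>k \<le> CARD('n)\<close>
proof (induction k)
  case 0
  then show ?case by (intro exI[of _ "{}"]) auto
next
  case (Suc k)
  then obtain T where T: "finite T" "card T = k"
    and on: "\<And>u v. u \<in> T \<Longrightarrow> v \<in> T \<Longrightarrow> u \<bullet> (S *v v) = (if u = v then 1 else 0)"
    by auto
  have comm: "u \<bullet> (S *v v) = v \<bullet> (S *v u)" for u v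
    by (metis dot_lmul_matrix inner_commute sym vector_transpose_matrix)
  \<comment> \<open>Fewer than \<open>CARD('n)\<close> vectors cannot span, so a vector outside the
    span exists; its \<open>S\<close>-orthogonal component \<open>y\<close> stays outside and is
    therefore nonzero.\<close>
  have "dim (span T) < DIM(real^'n)"
    using dim_le_card'[OF T(1)] T(2) Suc.prems by simp
  then have "span T \<noteq> UNIV"
    by (metis dim_UNIV less_irrefl)
  then obtain x where x: "x \<notin> span T" by auto
  define y where "y = x - (\<Sum>u\<in>T. (u \<bullet> (S *v x)) *\<^sub>R u)"
  have "(\<Sum>u\<in>T. (u \<bullet> (S *v x)) *\<^sub>R u) \<in> span T"
    by (intro span_sum span_scale span_base)
  then have "y \<notin> span T"
    using x unfolding y_def by (metis diff_add_cancel span_add)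
  then have ypos: "0 < y \<bullet> (S *v y)" using pos span_zero by metis
  define z where "z = (1 / sqrt (y \<bullet> (S *v y))) *\<^sub>R y"
  have zT: "z \<notin> T"
  proof
    assume "z \<in> T"
    then have "sqrt (y \<bullet> (S *v y)) *\<^sub>R z \<in> span T" by (intro span_scale span_base)
    then show False using \<open>y \<notin> span T\<close> ypos by (simp add: z_def)
  qed
  have zz: "z \<bullet> (S *v z) = 1"
    using ypos by (simp add: z_def matrix_vector_mult_scaleR real_sqrt_mult_self)
  have zu: "v \<bullet> (S *v z) = 0" if v: "v \<in> T" for v
  proof -
    have "v \<bullet> (S *v y) = v \<bullet> (S *v x) - (\<Sum>u\<in>T. (u \<bullet> (S *v x)) * (v \<bullet> (S *v u)))"
      by (simp add: y_def matrix_vector_mult_diff_distrib linear_sum[OF matrix_vector_mul_linear]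
          matrix_vector_mult_scaleR inner_diff_right inner_sum_right)
    also have "(\<Sum>u\<in>T. (u \<bullet> (S *v x)) * (v \<bullet> (S *v u))) = (\<Sum>u\<in>T. if u = v then u \<bullet> (S *v x) else 0)"
      using v by (intro sum.cong) (auto simp: on)
    finally show ?thesis
      using v T(1) by (simp add: z_def matrix_vector_mult_scaleR)
  qed
  show ?case
    using T zT zz zu zu[unfolded comm[of _ z]] on
    by (intro exI[of _ "insert z T"]) auto
qed

text \<open>Taking an \<open>S\<close>-orthonormal basis as the rows of \<open>A\<close> gives
  \<open>A ** S ** transpose A = mat 1\<close>. The diagonal entries and the determinant of this
  identity are the two claims.\<close>

lemma exists_whitening_matrix:
  fixes S :: "real^'n^'n"
  assumes "transpose S = S" and "\<And>v. v \<noteq> 0 \<Longrightarrow> 0 < v \<bullet> (S *v v)"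
  shows "\<exists>A. (\<forall>i. row i A \<bullet> (S *v row i A) = 1) \<and> (det A)\<^sup>2 * det S = 1"
proof -
  obtain T where T: "finite T" "card T = CARD('n)"
    and on: "\<And>u v. u \<in> T \<Longrightarrow> v \<in> T \<Longrightarrow> u \<bullet> (S *v v) = (if u = v then 1 else 0)"
    using exists_orthonormal_for_form[OF assms order.refl] by auto
  obtain a where a: "bij_betw a (UNIV :: 'n set) T"
    using finite_same_card_bij[of "UNIV :: 'n set" T] T by auto
  define A where "A = (\<chi> i. a i)"
  have rowA: "row i A = a i" for i
    by (simp add: A_def row_def vec_eq_iff)
  have aT: "a i \<in> T" for i using a by (auto simp: bij_betw_def)
  have ainj: "a i = a j \<longleftrightarrow> i = j" for i j using a by (auto simp: bij_betw_def inj_on_def)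
  have "(A ** S ** transpose A) $ i $ j = row i A \<bullet> (S *v row j A)" for i j
    by (simp add: matrix_matrix_mult_def matrix_vector_mult_def inner_vec_def transpose_def row_def
        sum_distrib_left sum_distrib_right mult.assoc) (rule sum.swap)
  then have "A ** S ** transpose A = mat 1"
    by (intro vec_eq_iff[THEN iffD2] allI) (simp add: rowA on aT ainj mat_def)
  then have "det (A ** S ** transpose A) = 1" by simp
  then have "(det A)\<^sup>2 * det S = 1"
    by (simp add: det_mul power2_eq_square mult_ac)
  moreover have "row i A \<bullet> (S *v row i A) = 1" for i
    by (simp add: rowA on aT)
  ultimately show ?thesis by blast
qed

text \<open>The substitution \<open>y = B *v (x - m)\<close> reduces this to the standard Gaussian;
  \<open>\<bar>det B\<bar>\<close> is its Jacobian.\<close>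

lemma nn_integral_gaussian_linear:
  fixes B :: "real^'n^'n" and m :: "real^'n"
  assumes "det B \<noteq> 0"
  shows "(\<integral>\<^sup>+x. ennreal (\<bar>det B\<bar> * (2 * pi) powr (- (real CARD('n) / 2))
      * exp (- (norm (B *v (x - m)))\<^sup>2 / 2)) \<partial>lborel) = 1"
proof -
  define G where "G = (\<lambda>y::real^'n. ennreal (exp (- (norm y)\<^sup>2 / 2)))"
  have [measurable]: "G \<in> borel_measurable borel" by (simp add: G_def)
  have [measurable]: "(\<lambda>x. B *v x) \<in> borel_measurable borel"
    by (intro borel_measurable_continuous_onI matrix_vector_mult_linear_continuous_on)
  have "ennreal ((2 * pi) powr (real CARD('n) / 2)) = (\<integral>\<^sup>+y. G y \<partial>lborel)"
    using nn_integral_gaussian[where 'a = "real^'n"] by (simp add: G_def)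
  also have "\<dots> = (\<integral>\<^sup>+y. G y \<partial>distr lborel borel ((+) (- (B *v m))))"
    by (simp add: lborel_distr_plus)
  also have "\<dots> = (\<integral>\<^sup>+y. G (- (B *v m) + y) \<partial>lborel)"
    by (rule nn_integral_distr) simp_all
  also have "\<dots> = ennreal \<bar>det (matrix ((*v) B))\<bar> * (\<integral>\<^sup>+x. G (- (B *v m) + B *v x) \<partial>lborel)"
    by (rule nn_integral_lborel_linear) (use assms in simp_all)
  also have "\<dots> = (\<integral>\<^sup>+x. ennreal \<bar>det B\<bar> * G (B *v (x - m)) \<partial>lborel)"
    by (simp add: nn_integral_cmult matrix_vector_mult_diff_distrib)
  finally have eq: "(\<integral>\<^sup>+x. ennreal \<bar>det B\<bar> * G (B *v (x - m)) \<partial>lborel) = ennreal ((2 * pi) powr (real CARD('n) / 2))"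
    by (rule sym)
  have "(\<integral>\<^sup>+x. ennreal (\<bar>det B\<bar> * (2 * pi) powr (- (real CARD('n) / 2))
      * exp (- (norm (B *v (x - m)))\<^sup>2 / 2)) \<partial>lborel)
      = (\<integral>\<^sup>+x. ennreal ((2 * pi) powr (- (real CARD('n) / 2))) * (ennreal \<bar>det B\<bar> * G (B *v (x - m))) \<partial>lborel)"
    by (intro nn_integral_cong) (simp add: G_def mult_ac flip: ennreal_mult)
  also have "\<dots> = ennreal ((2 * pi) powr (- (real CARD('n) / 2))) * ennreal ((2 * pi) powr (real CARD('n) / 2))"
    by (simp add: nn_integral_cmult eq)
  also have "\<dots> = 1"
    by (simp add: powr_minus flip: ennreal_mult)
  finally show ?thesis .
qed

section \<open>Covariance matrices of densities\<close>

text \<open>Makes the entries of \<open>cov_matrix\<close> genuine integrals. Each coordinate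
  difference is at most \<open>norm (x - m)\<close>, whose square is at most
  \<open>2 * (norm x)\<^sup>2 + 2 * (norm m)\<^sup>2\<close>.\<close>

lemma integrable_centered_moment:
  fixes f :: "real^'n \<Rightarrow> real"
  assumes "prob_density f" "finite_second_moment f"
  shows "integrable lebesgue (\<lambda>x. (x $ i - m $ i) * (x $ j - m $ j) * f x)"
proof (rule Bochner_Integration.integrable_bound)
  have f: "integrable lebesgue f" and f0: "\<And>x. 0 \<le> f x"
    using assms(1) by (auto simp: prob_density_def has_bochner_integral_iff)
  then have [measurable]: "f \<in> borel_measurable lebesgue" by auto
  show "integrable lebesgue (\<lambda>x. 2 * ((norm x)\<^sup>2 * f x) + 2 * (norm m)\<^sup>2 * f x)"
    using f assms(2) by (simp add: finite_second_moment_def)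
  have [measurable]: "(\<lambda>x::real^'n. x $ k) \<in> borel_measurable lebesgue" for k
    by (intro measurable_completion) simp
  show "(\<lambda>x. (x $ i - m $ i) * (x $ j - m $ j) * f x) \<in> borel_measurable lebesgue"
    by measurable
  have "\<bar>(x $ i - m $ i) * (x $ j - m $ j)\<bar> \<le> 2 * (norm x)\<^sup>2 + 2 * (norm m)\<^sup>2" for x
  proof -
    have "\<bar>(x $ i - m $ i) * (x $ j - m $ j)\<bar> \<le> norm (x - m) * norm (x - m)"
      unfolding abs_mult
      using component_le_norm_cart[of "x - m" i] component_le_norm_cart[of "x - m" j]
      by (intro mult_mono) auto
    also have "\<dots> \<le> (norm x + norm m) * (norm x + norm m)"
      by (intro mult_mono norm_triangle_ineq4) auto
    also have "\<dots> \<le> 2 * (norm x)\<^sup>2 + 2 * (norm m)\<^sup>2"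
      using sum_squares_bound[of "norm x" "norm m"] by (simp add: power2_eq_square algebra_simps)
    finally show ?thesis .
  qed
  from mult_right_mono[OF this f0]
  have "\<bar>(x $ i - m $ i) * (x $ j - m $ j) * f x\<bar> \<le> (2 * (norm x)\<^sup>2 + 2 * (norm m)\<^sup>2) * f x" for x
    unfolding abs_mult[of _ "f x"] abs_of_nonneg[OF f0] .
  then show "AE x in lebesgue. norm ((x $ i - m $ i) * (x $ j - m $ j) * f x)
      \<le> norm (2 * ((norm x)\<^sup>2 * f x) + 2 * (norm m)\<^sup>2 * f x)"
    using f0 by (intro AE_I2) (simp only: real_norm_def, simp add: distrib_right mult.assoc)
qed

lemma cov_matrix_form:
  fixes f :: "real^'n \<Rightarrow> real"
  assumes "prob_density f" "finite_second_moment f"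
  shows "has_bochner_integral lebesgue (\<lambda>x. (v \<bullet> (x - mean_vec f))\<^sup>2 * f x) (v \<bullet> (cov_matrix f *v v))"
proof -
  let ?c = "\<lambda>i j x. (x $ i - mean_vec f $ i) * (x $ j - mean_vec f $ j) * f x"
  have "has_bochner_integral lebesgue (\<lambda>x. \<Sum>i\<in>UNIV. \<Sum>j\<in>UNIV. v $ i * v $ j * ?c i j x)
      (\<Sum>i\<in>UNIV. \<Sum>j\<in>UNIV. v $ i * v $ j * (cov_matrix f $ i $ j))"
    using integrable_centered_moment[OF assms]
    by (intro has_bochner_integral_sum has_bochner_integral_mult_right)
      (simp add: has_bochner_integral_iff cov_matrix_def)
  moreover have "(\<Sum>i\<in>UNIV. \<Sum>j\<in>UNIV. v $ i * v $ j * ?c i j x) = (v \<bullet> (x - mean_vec f))\<^sup>2 * f x" for x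
  proof -
    have "(v \<bullet> y)\<^sup>2 = (\<Sum>i\<in>UNIV. \<Sum>j\<in>UNIV. v $ i * v $ j * (y $ i * y $ j))" for y
      by (simp only: inner_vec_def power2_eq_square sum_product) (simp add: mult_ac)
    then show ?thesis
      by (simp add: sum_distrib_right mult.assoc)
  qed
  moreover have "(\<Sum>i\<in>UNIV. \<Sum>j\<in>UNIV. v $ i * v $ j * (cov_matrix f $ i $ j)) = v \<bullet> (cov_matrix f *v v)"
    by (simp add: inner_vec_def matrix_vector_mult_def sum_distrib_left mult_ac)
  ultimately show ?thesis by simp
qed

text \<open>If the variance in direction \<open>v\<close> vanished, \<open>f\<close> would be
  concentrated on a hyperplane orthogonal to \<open>v\<close>. That is a null set, so
  \<open>f\<close> would have integral 0 instead of 1.\<close>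

lemma cov_matrix_pos_def:
  fixes f :: "real^'n \<Rightarrow> real"
  assumes "prob_density f" "finite_second_moment f" "v \<noteq> 0"
  shows "0 < v \<bullet> (cov_matrix f *v v)"
proof (rule ccontr)
  assume neg: "\<not> 0 < v \<bullet> (cov_matrix f *v v)"
  let ?q = "\<lambda>x. (v \<bullet> (x - mean_vec f))\<^sup>2 * f x"
  have f: "integral\<^sup>L lebesgue f = 1" and f0: "\<And>x. 0 \<le> f x"
    using assms(1) by (auto simp: prob_density_def has_bochner_integral_iff)
  have q: "integrable lebesgue ?q" "integral\<^sup>L lebesgue ?q = v \<bullet> (cov_matrix f *v v)"
    using cov_matrix_form[OF assms(1,2), of v] by (auto simp: has_bochner_integral_iff)
  have "0 \<le> integral\<^sup>L lebesgue ?q"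
    using f0 by (intro Bochner_Integration.integral_nonneg) auto
  then have "integral\<^sup>L lebesgue ?q = 0"
    using neg q(2) by simp
  then have "AE x in lebesgue. ?q x = 0"
    using integral_nonneg_eq_0_iff_AE[OF q(1)] f0 by auto
  moreover have "negligible {x. v \<bullet> x = v \<bullet> mean_vec f}"
    using assms(3) by (intro negligible_hyperplane) simp
  then have "AE x in lebesgue. v \<bullet> x \<noteq> v \<bullet> mean_vec f"
    by (intro AE_I') (auto simp: negligible_iff_null_sets)
  ultimately have "AE x in lebesgue. f x = 0"
    by eventually_elim (auto simp: inner_diff_right)
  then have "integral\<^sup>L lebesgue f = 0"
    by (rule integral_eq_zero_AE)
  with f show False by simp
qed

lemma transpose_cov_matrix: "transpose (cov_matrix f) = cov_matrix f"
  by (simp add: vec_eq_iff transpose_def cov_matrix_def mult.commute)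

section \<open>Comparison with the Gaussian of covariance \<Sigma>/P\<close>

theorem proposition1:
  fixes f :: "real ^ 'n \<Rightarrow> real"
    and \<Omega> :: "(real ^ 'n) set"
    and r :: ennreal
  assumes "prob_density f"
    and "finite_second_moment f"
    and "\<Omega> \<in> sets lebesgue"
    and "1 < r"
  shows "ennreal ((LINT x:\<Omega>|lebesgue. f x)
            powr (1 + real CARD('n) / 2 - real CARD('n) / 2 * enn2real (1 / r)))
         \<le> ennreal (((2 * pi * exp 1) powr (real CARD('n) / 2) * sqrt (det (cov_matrix f)))
              powr (1 - enn2real (1 / r)))
           * Lp_norm r (\<lambda>x. f x * indicator \<Omega> x)"
proof -
  define n where "n = real CARD('n)"
  define h where "h = (\<lambda>x. f x * indicator \<Omega> x)"
  define P where "P = (LINT x:\<Omega>|lebesgue. f x)"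
  define \<alpha> where "\<alpha> = 1 - enn2real (1 / r)"
  define K where "K = (2 * pi * exp 1) powr (n / 2) * sqrt (det (cov_matrix f))"
  define m where "m = mean_vec f"
  have f: "integrable lebesgue f" and f0: "\<And>x. 0 \<le> f x"
    using assms(1) by (auto simp: prob_density_def has_bochner_integral_iff)
  have h: "integrable lebesgue h" and h0: "\<And>x. 0 \<le> h x" and hf: "\<And>x. h x \<le> f x"
    using f f0 assms(3) unfolding h_def
    by (auto intro: integrable_real_mult_indicator split: split_indicator)
  have hP: "integral\<^sup>L lebesgue h = P"
    by (simp add: P_def h_def set_lebesgue_integral_def mult.commute)
  have \<alpha>: "0 \<le> \<alpha>"
  proof -
    have "1 / r \<le> 1"
      using assms(4) by (intro divide_le_posI_ennreal) (auto intro: order.strict_trans[OF zero_less_one])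
    then show ?thesis
      unfolding \<alpha>_def using enn2real_mono[of "1 / r" 1] by simp
  qed
  have "ennreal (P powr (1 + n / 2 * \<alpha>)) \<le> ennreal (K powr \<alpha>) * Lp_norm r h"
  \<comment> \<open>For \<open>P = 0\<close> the left side is 0, because
    \<open>0 powr x = 0\<close>; the Gaussian requires division of the covariance by
    \<open>P\<close>.\<close>
  proof (cases "P = 0")
    case False
    have "0 \<le> P"
      unfolding hP[symmetric] using h0 by (intro Bochner_Integration.integral_nonneg) auto
    with False have P: "0 < P" by simp
    obtain A where A: "\<And>i. row i A \<bullet> (cov_matrix f *v row i A) = 1"
      and det: "(det A)\<^sup>2 * det (cov_matrix f) = 1"
      using exists_whitening_matrix[OF transpose_cov_matrix cov_matrix_pos_def[OF assms(1,2)]] by blast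
    \<comment> \<open>With this scaling \<open>transpose B ** B\<close> is \<open>P\<close> times
      the inverse covariance matrix, so \<open>\<kappa> * exp (- q x / 2)\<close> is the Gaussian
      density with mean \<open>m\<close> and covariance \<open>cov_matrix f\<close> divided by
      \<open>P\<close>.\<close>
    define B where "B = (\<chi> i. sqrt P *s A $ i)"
    define q where "q = (\<lambda>x. (norm (B *v (x - m)))\<^sup>2)"
    define \<kappa> where "\<kappa> = \<bar>det B\<bar> * (2 * pi) powr (- (n / 2))"
    have detA: "det A \<noteq> 0" using det by auto
    then have detC: "0 < det (cov_matrix f)"
      using zero_less_mult_pos[of "(det A)\<^sup>2" "det (cov_matrix f)"] det by simp
    have absdetA: "\<bar>det A\<bar> * sqrt (det (cov_matrix f)) = 1"
      using arg_cong[OF det, of sqrt] by (simp add: real_sqrt_mult)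
    have detB: "\<bar>det B\<bar> = P powr (n / 2) * \<bar>det A\<bar>"
      using P unfolding B_def det_rows_mul
      by (simp add: abs_mult n_def powr_half_sqrt[symmetric] powr_power)
    then have detB0: "det B \<noteq> 0" using P detA by auto
    have \<kappa>: "0 < \<kappa>" using detB0 by (simp add: \<kappa>_def)
    have q_eq: "q x = P * (\<Sum>i\<in>UNIV. (row i A \<bullet> (x - m))\<^sup>2)" for x
    proof -
      have "(B *v y) $ i = sqrt P * (row i A \<bullet> y)" for y i
        by (simp add: B_def matrix_vector_mul_component row_def inner_vec_def sum_distrib_left mult_ac)
      then show ?thesis
        using P unfolding q_def power2_norm_eq_inner
        by (simp add: inner_vec_def sum_distrib_left power2_eq_square mult_ac)
          (simp flip: mult.assoc)
    qed
    \<comment> \<open>Each row of \<open>A\<close> contributes variance 1, so the \<open>n\<close>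
      rows give \<open>n\<close>, scaled by \<open>P\<close>.\<close>
    have fq: "has_bochner_integral lebesgue (\<lambda>x. f x * q x) (n * P)"
    proof -
      have "has_bochner_integral lebesgue (\<lambda>x. P * (\<Sum>i\<in>UNIV. (row i A \<bullet> (x - m))\<^sup>2 * f x))
          (P * (\<Sum>i\<in>(UNIV :: 'n set). row i A \<bullet> (cov_matrix f *v row i A)))"
        unfolding m_def
        by (intro has_bochner_integral_mult_right has_bochner_integral_sum cov_matrix_form assms)
      moreover have "P * (\<Sum>i\<in>UNIV. (row i A \<bullet> (x - m))\<^sup>2 * f x) = f x * q x" for x
        by (simp add: q_eq sum_distrib_left sum_distrib_right mult_ac)
      ultimately show ?thesis by (simp add: A n_def mult.commute)
    qed
    have hq_eq: "h x * q x = f x * q x * indicator \<Omega> x" for x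
      by (simp add: h_def)
    have hq: "integrable lebesgue (\<lambda>x. h x * q x)"
      unfolding hq_eq using fq assms(3)
      by (intro integrable_real_mult_indicator) (auto simp: has_bochner_integral_iff)
    \<comment> \<open>As \<open>h\<close> has mass \<open>P\<close>, this bounds the mean of
      \<open>q\<close> under \<open>h / P\<close> by \<open>n\<close>, the value of \<open>d\<close>
      in Jensen's inequality. The factor \<open>P\<close> in the covariance was chosen for
      this.\<close>
    have "(\<integral>x. h x * q x \<partial>lebesgue) \<le> (\<integral>x. f x * q x \<partial>lebesgue)"
      using fq hq hf by (intro integral_mono) (auto simp: has_bochner_integral_iff q_def intro: mult_right_mono)
    then have hq_le: "(\<integral>x. h x * q x \<partial>lebesgue) \<le> n * integral\<^sup>L lebesgue h"
      using fq by (simp add: has_bochner_integral_iff hP)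
    have [measurable]: "(\<lambda>x. B *v x) \<in> borel_measurable borel"
      by (intro borel_measurable_continuous_onI matrix_vector_mult_linear_continuous_on)
    have q_borel: "q \<in> borel_measurable lborel" unfolding q_def by measurable
    then have [measurable]: "q \<in> borel_measurable lebesgue" by (rule measurable_completion)
    have "ennreal (P * (\<kappa> * exp (- n / 2)) powr \<alpha>)
        \<le> (\<integral>\<^sup>+x. ennreal (h x * (\<kappa> * exp (- q x / 2)) powr \<alpha>) \<partial>lebesgue)"
      using Jensen_exp_powr[OF h h0 hq hq_le _ \<kappa> \<alpha>] unfolding hP by simp
    also have "\<dots> \<le> Lp_norm r h"
      unfolding \<alpha>_def
    proof (rule Holder_Lp_norm)
      show "(\<integral>\<^sup>+x. ennreal (\<kappa> * exp (- q x / 2)) \<partial>lebesgue) \<le> 1"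
        unfolding nn_integral_completion \<kappa>_def n_def q_def nn_integral_gaussian_linear[OF detB0] ..
    qed (use h h0 \<kappa> assms(4) in auto)
    finally have main: "ennreal (P * (\<kappa> * exp (- n / 2)) powr \<alpha>) \<le> Lp_norm r h" .
    have K: "0 < K" using detC by (simp add: K_def)
    \<comment> \<open>The constant in \<open>K\<close> is explained here: its powers of
      \<open>2 * pi\<close> and of \<open>exp 1\<close> cancel the Gaussian normalisation and the
      Jensen factor, and the determinants cancel by whitening. Only the scaling of \<open>B\<close>
      by \<open>sqrt P\<close> survives.\<close>
    have "K * (\<kappa> * exp (- n / 2)) = P powr (n / 2) * (\<bar>det A\<bar> * sqrt (det (cov_matrix f)))
        * ((2 * pi) powr (n / 2) * (2 * pi) powr - (n / 2)) * (exp 1 powr (n / 2) * exp (- n / 2))"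
      by (simp add: K_def \<kappa>_def detB powr_mult mult_ac)
    also have "\<dots> = P powr (n / 2)"
      by (simp add: absdetA powr_minus exp_minus powr_def[of "exp 1"])
    finally have "P powr (1 + n / 2 * \<alpha>) = K powr \<alpha> * (P * (\<kappa> * exp (- n / 2)) powr \<alpha>)"
      using P K \<kappa> by (simp add: powr_add powr_powr powr_mult[symmetric] mult_ac)
    then show ?thesis
      using P mult_left_mono[OF main, of "ennreal (K powr \<alpha>)"] by (simp add: ennreal_mult)
  qed simp
  moreover have "1 + n / 2 * \<alpha> = 1 + n / 2 - n / 2 * enn2real (1 / r)"
    by (simp only: \<alpha>_def right_diff_distrib)
  ultimately show ?thesis
    by (simp only: n_def h_def P_def \<alpha>_def K_def)
qed

end
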